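(* Let $X$ be a $T_1$-space. If $X$ carries the inductive topology with respect to a countable cover $\mathcal C$ of $X$ by subspaces possessing countable Pytkeev networks, then $X$ has a countable Pytkeev network.
   Context: A topological space $X$ carries the inductive topology with respect to a family $\mathcal C$ of its subspaces if a subset $U\subset X$ is open in $X$ if and only if for every $C\in\mathcal C$ the intersection $C\cap U$ is open in the subspace topology of $C$. A subset $A$ of a topological space $X$ accumulates at a point $x\in X$ if each neighborhood of $x$ contains infinitely many points of $A$. A family $\mathcal N$ of subsets of $X$ is a network at $x\in X$ if for any neighborhood $O_x$ of $x$ there is $N\in\mathcal N$ with $x\in N\subset O_x$. It is a Pytkeev network at $x$ if it is a network at $x$ and for each neighborhood $O_x$ of $x$ and each subset $A\subset X$ accumulating at $x$ there is $N\in\mathcal N$ such that $N\subset O_x$ and $N\cap A$ is infinite. It is a Pytkeev network for $X$ if it is a Pytkeev network at each point $x\in X$. *)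

theory Defs
  imports "HOL-Analysis.T1_Spaces"
begin

text \<open>Neighborhoods are not required to be open.\<close>

definition neighborhood_of :: "'a topology \<Rightarrow> 'a \<Rightarrow> 'a set \<Rightarrow> bool" where
  "neighborhood_of X x V \<longleftrightarrow> V \<subseteq> topspace X \<and> x \<in> X interior_of V"

text \<open>The members of \<open>\<C>\<close> carry the subspace topology inherited from \<open>X\<close>.\<close>

definition carries_inductive_topology :: "'a topology \<Rightarrow> 'a set set \<Rightarrow> bool" where
  "carries_inductive_topology X \<C> \<longleftrightarrow>
     (\<forall>U. U \<subseteq> topspace X \<longrightarrow>
        (openin X U \<longleftrightarrow> (\<forall>C\<in>\<C>. openin (subtopology X C) (C \<inter> U))))"

definition accumulates_at :: "'a topology \<Rightarrow> 'a set \<Rightarrow> 'a \<Rightarrow> bool" where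
  "accumulates_at X A x \<longleftrightarrow> (\<forall>V. neighborhood_of X x V \<longrightarrow> infinite (V \<inter> A))"

definition network_at :: "'a topology \<Rightarrow> 'a \<Rightarrow> 'a set set \<Rightarrow> bool" where
  "network_at X x \<N> \<longleftrightarrow>
     \<N> \<subseteq> Pow (topspace X) \<and>
     (\<forall>V. neighborhood_of X x V \<longrightarrow> (\<exists>N\<in>\<N>. x \<in> N \<and> N \<subseteq> V))"

definition pytkeev_network_at :: "'a topology \<Rightarrow> 'a \<Rightarrow> 'a set set \<Rightarrow> bool" where
  "pytkeev_network_at X x \<N> \<longleftrightarrow>
     network_at X x \<N> \<and>
     (\<forall>V A. neighborhood_of X x V \<and> A \<subseteq> topspace X \<and> accumulates_at X A x \<longrightarrow>
        (\<exists>N\<in>\<N>. N \<subseteq> V \<and> infinite (N \<inter> A)))"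

text \<open>The first conjunct matters only when \<open>X\<close> is the empty space.\<close>

definition pytkeev_network :: "'a topology \<Rightarrow> 'a set set \<Rightarrow> bool" where
  "pytkeev_network X \<N> \<longleftrightarrow>
     \<N> \<subseteq> Pow (topspace X) \<and> (\<forall>x\<in>topspace X. pytkeev_network_at X x \<N>)"

end

theory Submission imports Defs begin

text \<open>
  The union of countable Pytkeev networks of the pieces \<open>C \<in> \<C>\<close> is a countable Pytkeev network
  of \<open>X\<close>.  The difficulty is that a set \<open>A\<close> accumulating at \<open>x\<close> in \<open>X\<close> need not accumulate at
  \<open>x\<close> within any piece: in the Arens space, the inductive topology of countably many convergent
  sequences, the isolated points accumulate at the top point without any of the sequences
  witnessing it.

  The member \<open>N\<close> required by the Pytkeev property at \<open>x\<close>, however, need not contain \<open>x\<close>; it only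
  has to lie in the given neighborhood \<open>V\<close> of \<open>x\<close> and meet \<open>A\<close> in an infinite set.  Hence it
  suffices that \<open>A\<close> accumulates, within some piece \<open>C\<close>, at \<^emph>\<open>some\<close> point \<open>y\<close> of the interior
  \<open>U\<close> of \<open>V\<close> (\<open>accumulation_in_some_piece\<close>), for then the network of \<open>C\<close> at \<open>y\<close> supplies \<open>N\<close>.
  If there were no such \<open>y\<close>, the trace of \<open>A\<close> on each piece would be locally finite along \<open>U\<close>.
  As the pieces are \<open>T\<^sub>1\<close>, removing \<open>A - {x}\<close> from \<open>U\<close> would then leave a set with open trace on
  each piece, so an open neighborhood of \<open>x\<close> in \<open>X\<close> that meets \<open>A\<close> at most in \<open>x\<close>,
  contrary to accumulation.
\<close>

lemma neighborhood_of_openin: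
  "openin X U \<Longrightarrow> x \<in> U \<Longrightarrow> neighborhood_of X x U"
  by (simp add: neighborhood_of_def interior_of_openin openin_subset)

text \<open>
  Around a point of \<open>U\<close>, only finitely many points of \<open>A\<close> matter, and in a \<open>T\<^sub>1\<close>-space finite
  sets are closed.
\<close>

lemma openin_diff_if_no_accumulation:
  assumes "t1_space X" and "openin X U" and "B \<subseteq> A"
    and no_acc: "\<And>y. y \<in> U \<Longrightarrow> \<not> accumulates_at X A y"
  shows "openin X (U - B)"
proof (subst openin_subopen, intro ballI)
  fix y assume y: "y \<in> U - B"
  then obtain V where V: "neighborhood_of X y V" and fin: "finite (V \<inter> A)"
    using no_acc[of y] by (auto simp: accumulates_at_def)
  define W where "W = U \<inter> X interior_of V - V \<inter> B"
  have "V \<inter> B \<subseteq> topspace X"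
    using V by (auto simp: neighborhood_of_def)
  moreover have "finite (V \<inter> B)"
    using fin \<open>B \<subseteq> A\<close> by (meson Int_mono finite_subset order_refl)
  ultimately have "closedin X (V \<inter> B)"
    using \<open>t1_space X\<close> by (simp add: t1_space_closedin_finite)
  then have "openin X W"
    unfolding W_def using \<open>openin X U\<close> by (intro openin_diff openin_Int) auto
  moreover have "y \<in> W"
    using V y by (auto simp: W_def neighborhood_of_def)
  moreover have "W \<subseteq> U - B"
    using interior_of_subset[of X V] by (auto simp: W_def)
  ultimately show "\<exists>T. openin X T \<and> y \<in> T \<and> T \<subseteq> U - B"
    by blast
qed

text \<open>
  If \<open>A\<close> accumulated at no point of \<open>U\<close> within any piece, then \<open>U - (A - {x})\<close> would have an
  open trace on every piece and hence be an open neighborhood of \<open>x\<close> almost disjoint from \<open>A\<close>.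
  In general \<open>y\<close> has to be allowed to differ from \<open>x\<close>.
\<close>

lemma accumulation_in_some_piece:
  assumes t1: "t1_space X" and sub: "\<C> \<subseteq> Pow (topspace X)"
    and ind: "carries_inductive_topology X \<C>"
    and U: "openin X U" "x \<in> U" and acc: "accumulates_at X A x"
  obtains C y where "C \<in> \<C>" "y \<in> C \<inter> U" "accumulates_at (subtopology X C) (A \<inter> C) y"
proof (rule ccontr)
  assume "\<not> thesis"
  with that have no_acc: "\<not> accumulates_at (subtopology X C) (A \<inter> C) y"
    if "C \<in> \<C>" "y \<in> C \<inter> U" for C y
    using that by blast
  \<comment> \<open>The point \<open>x\<close> is kept even if it lies in \<open>A\<close>: the remaining set has to be a neighborhood
    of \<open>x\<close>.\<close>
  define W where "W = U - (A - {x})"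
  have "openin (subtopology X C) (C \<inter> W)" if "C \<in> \<C>" for C
  proof -
    have "openin (subtopology X C) (C \<inter> U - (A \<inter> C - {x}))"
    proof (rule openin_diff_if_no_accumulation[where A = "A \<inter> C"])
      show "t1_space (subtopology X C)"
        by (rule t1_space_subtopology[OF t1])
      show "openin (subtopology X C) (C \<inter> U)"
        using U(1) by (rule openin_subtopology_Int2)
    qed (use no_acc that in auto)
    moreover have "C \<inter> U - (A \<inter> C - {x}) = C \<inter> W"
      by (auto simp: W_def)
    ultimately show ?thesis by simp
  qed
  moreover have "W \<subseteq> topspace X"
    using openin_subset[OF U(1)] by (auto simp: W_def)
  ultimately have "openin X W"
    using ind by (auto simp: carries_inductive_topology_def)
  then have "neighborhood_of X x W"
    using U(2) by (intro neighborhood_of_openin) (auto simp: W_def)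
  moreover have "finite (W \<inter> A)"
    by (rule finite_subset[of _ "{x}"]) (auto simp: W_def)
  ultimately show False
    using acc by (auto simp: accumulates_at_def)
qed

theorem theorem3p3:
  fixes X :: "'a topology" and \<C> :: "'a set set"
  assumes "t1_space X"
    and "countable \<C>"
    and "\<C> \<subseteq> Pow (topspace X)"
    and "\<Union>\<C> = topspace X"
    and "carries_inductive_topology X \<C>"
    and "\<And>C. C \<in> \<C> \<Longrightarrow> \<exists>\<N>. countable \<N> \<and> pytkeev_network (subtopology X C) \<N>"
  shows "\<exists>\<N>. countable \<N> \<and> pytkeev_network X \<N>"
proof -
  obtain F where countF: "\<And>C. C \<in> \<C> \<Longrightarrow> countable (F C)"
    and F: "\<And>C. C \<in> \<C> \<Longrightarrow> pytkeev_network (subtopology X C) (F C)"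
    using assms(6) by metis
  have top: "topspace (subtopology X C) = C" if "C \<in> \<C>" for C
    using assms(3) that by (auto simp: topspace_subtopology)
  have F_at: "pytkeev_network_at (subtopology X C) y (F C)" if "C \<in> \<C>" "y \<in> C" for C y
    using F[OF that(1)] that top by (auto simp: pytkeev_network_def)
  have trace: "neighborhood_of (subtopology X C) y (C \<inter> U)"
    if "openin X U" "y \<in> C" "y \<in> U" for C U y
    using that by (intro neighborhood_of_openin openin_subtopology_Int2) auto
  define \<N> where "\<N> = (\<Union>C\<in>\<C>. F C)"
  have "countable \<N>"
    unfolding \<N>_def using assms(2) countF by blast
  moreover have "pytkeev_network X \<N>"
  proof -
    have Pow: "\<N> \<subseteq> Pow (topspace X)"
      using F top assms(3) unfolding \<N>_def pytkeev_network_def by fastforce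
    have "\<exists>N\<in>\<N>. x \<in> N \<and> N \<subseteq> V" if "x \<in> topspace X" "neighborhood_of X x V" for x V
    proof -
      from that(1) obtain C where C: "C \<in> \<C>" "x \<in> C"
        using assms(4) by blast
      have "neighborhood_of (subtopology X C) x (C \<inter> X interior_of V)"
        using that(2) C by (intro trace) (auto simp: neighborhood_of_def)
      then obtain N where "N \<in> F C" "x \<in> N" "N \<subseteq> C \<inter> X interior_of V"
        using F_at[OF C] unfolding pytkeev_network_at_def network_at_def by meson
      then show ?thesis
        using C(1) interior_of_subset[of X V] unfolding \<N>_def by blast
    qed
    moreover have "\<exists>N\<in>\<N>. N \<subseteq> V \<and> infinite (N \<inter> A)"
      if V: "neighborhood_of X x V" and acc: "accumulates_at X A x" for x V A
    proof -
      have "openin X (X interior_of V)" "x \<in> X interior_of V"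
        using V by (auto simp: neighborhood_of_def)
      then obtain C y where C: "C \<in> \<C>" and y: "y \<in> C \<inter> X interior_of V"
        and acc': "accumulates_at (subtopology X C) (A \<inter> C) y"
        using accumulation_in_some_piece[OF assms(1,3,5) _ _ acc] by metis
      have "neighborhood_of (subtopology X C) y (C \<inter> X interior_of V)"
        using y by (intro trace) auto
      moreover have "A \<inter> C \<subseteq> topspace (subtopology X C)"
        using top[OF C] by simp
      ultimately obtain N where N: "N \<in> F C" "N \<subseteq> C \<inter> X interior_of V" "infinite (N \<inter> (A \<inter> C))"
        using F_at[OF C, of y] y acc' unfolding pytkeev_network_at_def by blast
      have "infinite (N \<inter> A)"
        using N(3) by (rule contrapos_nn) (auto elim: rev_finite_subset)
      then show ?thesis
        using C N(1,2) interior_of_subset[of X V] unfolding \<N>_def by blast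
    qed
    ultimately show ?thesis
      using Pow by (auto simp: pytkeev_network_def pytkeev_network_at_def network_at_def)
  qed
  ultimately show ?thesis by blast
qed

end
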